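(* Let $(M,\phi,\xi,\eta,g,\nabla=\nabla^\circ+K)$ be an almost contact statistical manifold. Then the $\phi$-sectional $K$-curvature of $M$ is non-positive, i.e. for every $p\in M$ and every nonzero $X\in T_pM$ orthogonal to $\xi$, $\mathcal{K}_\phi(X)\le 0$.
   Context: An almost contact metric manifold $(M,\phi,\xi,\eta,g)$ is an odd-dimensional smooth manifold $M$ with a $(1,1)$-tensor field $\phi$, a vector field $\xi$, a 1-form $\eta$ and a Riemannian metric $g$ satisfying $\phi^2=-I+\eta\otimes\xi$, $\eta(\xi)=1$ and $g(\phi X,\phi Y)=g(X,Y)-\eta(X)\eta(Y)$ for all vector fields $X,Y$. Let $\nabla^\circ$ be the Levi-Civita connection of $g$. A statistical structure on $M$ is a pair $(g,\nabla)$ with $\nabla$ a torsion-free affine connection such that the 3-tensor $\nabla g$ is totally symmetric; put $K=\nabla-\nabla^\circ$, a $(1,2)$-tensor field which is symmetric, and such that $g(X,K(Y,Z))$ is totally symmetric in $X,Y,Z$. An almost contact statistical manifold $(M,\phi,\xi,\eta,g,\nabla=\nabla^\circ+K)$ is an almost contact metric manifold with a statistical structure $(g,\nabla)$ such that $K(X,\phi Y)+\phi K(X,Y)=0$ for all vector fields $X,Y$. Write $K_XY=K(X,Y)$ and $[K,K](X,Y)Z=K_XK_YZ-K_YK_XZ$. A $\phi$-section of $T_pM$ is a 2-dimensional subspace spanned by $\{X,\phi X\}$ for some $X\in T_pM$ orthogonal to $\xi$. The $\phi$-sectional $K$-curvature of this $\phi$-section is $$\mathcal{K}_\phi(X)=\frac{g([K,K](X,\phi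 X)\phi X,X)}{Q(X,\phi X)},\qquad Q(X,\phi X)=g(X,X)g(\phi X,\phi X)-g(X,\phi X)^2 .$$ *)

theory Defs
  imports "HOL-Analysis.Analysis"
begin

section \<open>Smooth maps between Euclidean spaces\<close>

text \<open>These notions are meant for open \<open>S\<close> only. In a finite-dimensional space, \<open>f\<close> is of class
  \<open>C\<^sup>k\<^sup>+\<^sup>1\<close> on \<open>S\<close> iff it is differentiable on \<open>S\<close> and all its directional derivatives are of
  class \<open>C\<^sup>k\<close>.\<close>

primrec Ck_on :: "nat \<Rightarrow> ('e::euclidean_space \<Rightarrow> 'f::real_normed_vector) \<Rightarrow> 'e set \<Rightarrow> bool" where
  "Ck_on 0 f S \<longleftrightarrow> continuous_on S f"
| "Ck_on (Suc k) f S \<longleftrightarrow>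
     (\<forall>x\<in>S. f differentiable (at x)) \<and>
     (\<forall>v. Ck_on k (\<lambda>x. frechet_derivative f (at x) v) S)"

definition smooth_on :: "('e::euclidean_space \<Rightarrow> 'f::real_normed_vector) \<Rightarrow> 'e set \<Rightarrow> bool" where
  "smooth_on f S \<longleftrightarrow> (\<forall>k. Ck_on k f S)"

section \<open>Smooth manifolds\<close>

text \<open>The manifold is the whole type \<open>'a\<close>, modelled on \<open>'e\<close>. A chart is a pair \<open>(U, x)\<close> of an open
  set and a coordinate map; only the values of \<open>x\<close> on \<open>U\<close> matter. The smooth structure is given by
  an atlas, which need not be maximal.\<close>

type_synonym ('a, 'e) chart = "'a set \<times> ('a \<Rightarrow> 'e)"

definition is_chart :: "('a::topological_space, 'e::euclidean_space) chart \<Rightarrow> bool" where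
  "is_chart = (\<lambda>(U, x). open U \<and> open (x ` U) \<and> homeomorphism U (x ` U) x (inv_into U x))"

locale smooth_manifold =
  fixes A :: "('a::{t2_space, second_countable_topology}, 'e::euclidean_space) chart set"
  assumes charts: "c \<in> A \<Longrightarrow> is_chart c"
    and cover: "(\<Union>(U, x)\<in>A. U) = UNIV"
    and compatible: "(U, x) \<in> A \<Longrightarrow> (V, y) \<in> A \<Longrightarrow> smooth_on (y \<circ> inv_into U x) (x ` (U \<inter> V))"

definition smooth_functions :: "('a, 'e::euclidean_space) chart set \<Rightarrow> ('a \<Rightarrow> real) set" where
  "smooth_functions A = {f. \<forall>(U, x)\<in>A. smooth_on (f \<circ> inv_into U x) (x ` U)}"

section \<open>Tangent vectors and vector fields\<close>

text \<open>A tangent vector at \<open>p\<close> is a derivative operator \<open>f \<mapsto> \<Sum>\<^sub>i v\<^sup>i (\<partial>f/\<partial>x\<^sup>i)(p)\<close> on the smooth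
  functions, with \<open>x\<close> a chart around \<open>p\<close>. Since the operator is a total HOL function, it is set to
  \<open>0\<close> outside the smooth functions; so equality of tangent vectors is equality in HOL, and the
  vector space operations are those of functions.\<close>

type_synonym 'a tangent = "('a \<Rightarrow> real) \<Rightarrow> real"

definition coord_vector ::
    "('a, 'e::euclidean_space) chart set \<Rightarrow> ('a, 'e) chart \<Rightarrow> 'a \<Rightarrow> 'e \<Rightarrow> 'a tangent" where
  "coord_vector A = (\<lambda>(U, x) p v f.
     if f \<in> smooth_functions A then frechet_derivative (f \<circ> inv_into U x) (at (x p)) v else 0)"

definition tangent_space :: "('a, 'e::euclidean_space) chart set \<Rightarrow> 'a \<Rightarrow> 'a tangent set" where
  "tangent_space A p = {coord_vector A (U, x) p v |U x v. (U, x) \<in> A \<and> p \<in> U}"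

definition tzero :: "'a tangent" where
  "tzero = (\<lambda>f. 0)"

definition lincomb :: "real \<Rightarrow> 'a tangent \<Rightarrow> real \<Rightarrow> 'a tangent \<Rightarrow> 'a tangent" where
  "lincomb a u b v = (\<lambda>f. a * u f + b * v f)"

type_synonym 'a vfield = "'a \<Rightarrow> 'a tangent"

definition vector_fields :: "('a, 'e::euclidean_space) chart set \<Rightarrow> 'a vfield set" where
  "vector_fields A = {X. (\<forall>p. X p \<in> tangent_space A p) \<and>
     (\<forall>f\<in>smooth_functions A. (\<lambda>p. X p f) \<in> smooth_functions A)}"

text \<open>For \<open>f\<close> that is not smooth, both summands vanish, in accordance with the convention above.\<close>

definition lie_bracket :: "'a vfield \<Rightarrow> 'a vfield \<Rightarrow> 'a vfield" where
  "lie_bracket X Y = (\<lambda>p f. X p (\<lambda>q. Y q f) - Y p (\<lambda>q. X q f))"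

section \<open>Tensor fields\<close>

text \<open>Tensor fields are families of multilinear maps on the tangent spaces, smooth in the sense that
  they yield smooth functions or vector fields when applied to smooth vector fields.\<close>

definition linear_form_on :: "'a tangent set \<Rightarrow> ('a tangent \<Rightarrow> real) \<Rightarrow> bool" where
  "linear_form_on T F \<longleftrightarrow>
     (\<forall>u\<in>T. \<forall>v\<in>T. \<forall>a b. F (lincomb a u b v) = a * F u + b * F v)"

definition linear_map_on :: "'a tangent set \<Rightarrow> ('a tangent \<Rightarrow> 'a tangent) \<Rightarrow> bool" where
  "linear_map_on T F \<longleftrightarrow> (\<forall>u\<in>T. F u \<in> T) \<and>
     (\<forall>u\<in>T. \<forall>v\<in>T. \<forall>a b. F (lincomb a u b v) = lincomb a (F u) b (F v))"

definition one_form :: "('a, 'e::euclidean_space) chart set \<Rightarrow> ('a \<Rightarrow> 'a tangent \<Rightarrow> real) \<Rightarrow> bool" where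
  "one_form A \<eta> \<longleftrightarrow> (\<forall>p. linear_form_on (tangent_space A p) (\<eta> p)) \<and>
     (\<forall>X\<in>vector_fields A. (\<lambda>p. \<eta> p (X p)) \<in> smooth_functions A)"

definition tensor_1_1 ::
    "('a, 'e::euclidean_space) chart set \<Rightarrow> ('a \<Rightarrow> 'a tangent \<Rightarrow> 'a tangent) \<Rightarrow> bool" where
  "tensor_1_1 A \<phi> \<longleftrightarrow> (\<forall>p. linear_map_on (tangent_space A p) (\<phi> p)) \<and>
     (\<forall>X\<in>vector_fields A. (\<lambda>p. \<phi> p (X p)) \<in> vector_fields A)"

definition tensor_1_2 ::
    "('a, 'e::euclidean_space) chart set \<Rightarrow>
     ('a \<Rightarrow> 'a tangent \<Rightarrow> 'a tangent \<Rightarrow> 'a tangent) \<Rightarrow> bool" where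
  "tensor_1_2 A K \<longleftrightarrow>
     (\<forall>p. \<forall>u\<in>tangent_space A p.
        linear_map_on (tangent_space A p) (K p u) \<and>
        linear_map_on (tangent_space A p) (\<lambda>v. K p v u)) \<and>
     (\<forall>X\<in>vector_fields A. \<forall>Y\<in>vector_fields A. (\<lambda>p. K p (X p) (Y p)) \<in> vector_fields A)"

definition riemannian_metric ::
    "('a, 'e::euclidean_space) chart set \<Rightarrow> ('a \<Rightarrow> 'a tangent \<Rightarrow> 'a tangent \<Rightarrow> real) \<Rightarrow> bool" where
  "riemannian_metric A g \<longleftrightarrow>
     (\<forall>p. \<forall>u\<in>tangent_space A p. linear_form_on (tangent_space A p) (g p u)) \<and>
     (\<forall>p. \<forall>u\<in>tangent_space A p. \<forall>v\<in>tangent_space A p. g p u v = g p v u) \<and>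
     (\<forall>p. \<forall>u\<in>tangent_space A p. u \<noteq> tzero \<longrightarrow> 0 < g p u u) \<and>
     (\<forall>X\<in>vector_fields A. \<forall>Y\<in>vector_fields A. (\<lambda>p. g p (X p) (Y p)) \<in> smooth_functions A)"

section \<open>Connections and statistical structures\<close>

type_synonym 'a connection = "'a vfield \<Rightarrow> 'a vfield \<Rightarrow> 'a vfield"

definition affine_connection ::
    "('a, 'e::euclidean_space) chart set \<Rightarrow> 'a connection \<Rightarrow> bool" where
  "affine_connection A D \<longleftrightarrow>
     (\<forall>X\<in>vector_fields A. \<forall>Y\<in>vector_fields A. D X Y \<in> vector_fields A) \<and>
     (\<forall>X\<in>vector_fields A. \<forall>Y\<in>vector_fields A. \<forall>Z\<in>vector_fields A.
        \<forall>f\<in>smooth_functions A. \<forall>h\<in>smooth_functions A.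
        D (\<lambda>p. lincomb (f p) (X p) (h p) (Y p)) Z
          = (\<lambda>p. lincomb (f p) (D X Z p) (h p) (D Y Z p))) \<and>
     (\<forall>X\<in>vector_fields A. \<forall>Y\<in>vector_fields A. \<forall>Z\<in>vector_fields A.
        D X (\<lambda>p. lincomb 1 (Y p) 1 (Z p)) = (\<lambda>p. lincomb 1 (D X Y p) 1 (D X Z p))) \<and>
     (\<forall>X\<in>vector_fields A. \<forall>Y\<in>vector_fields A. \<forall>f\<in>smooth_functions A.
        D X (\<lambda>p q. f p * Y p q) = (\<lambda>p. lincomb (X p f) (Y p) (f p) (D X Y p)))"

definition torsion_free ::
    "('a, 'e::euclidean_space) chart set \<Rightarrow> 'a connection \<Rightarrow> bool" where
  "torsion_free A D \<longleftrightarrow> (\<forall>X\<in>vector_fields A. \<forall>Y\<in>vector_fields A.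
     (\<lambda>p. lincomb 1 (D X Y p) (- 1) (D Y X p)) = lie_bracket X Y)"

text \<open>The covariant derivative \<open>(\<nabla>\<^sub>X g)(Y, Z) = X(g(Y, Z)) - g(\<nabla>\<^sub>X Y, Z) - g(Y, \<nabla>\<^sub>X Z)\<close>.\<close>

definition nabla_metric ::
    "('a \<Rightarrow> 'a tangent \<Rightarrow> 'a tangent \<Rightarrow> real) \<Rightarrow> 'a connection \<Rightarrow>
     'a vfield \<Rightarrow> 'a vfield \<Rightarrow> 'a vfield \<Rightarrow> 'a \<Rightarrow> real" where
  "nabla_metric g D X Y Z = (\<lambda>p.
     X p (\<lambda>q. g q (Y q) (Z q)) - g p (D X Y p) (Z p) - g p (Y p) (D X Z p))"

definition levi_civita_connection ::
    "('a, 'e::euclidean_space) chart set \<Rightarrow> ('a \<Rightarrow> 'a tangent \<Rightarrow> 'a tangent \<Rightarrow> real) \<Rightarrow>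
     'a connection \<Rightarrow> bool" where
  "levi_civita_connection A g D \<longleftrightarrow> affine_connection A D \<and> torsion_free A D \<and>
     (\<forall>X\<in>vector_fields A. \<forall>Y\<in>vector_fields A. \<forall>Z\<in>vector_fields A.
        nabla_metric g D X Y Z = (\<lambda>p. 0))"

text \<open>The two transpositions below generate all permutations of \<open>X, Y, Z\<close>.\<close>

definition statistical_structure ::
    "('a, 'e::euclidean_space) chart set \<Rightarrow> ('a \<Rightarrow> 'a tangent \<Rightarrow> 'a tangent \<Rightarrow> real) \<Rightarrow>
     'a connection \<Rightarrow> bool" where
  "statistical_structure A g D \<longleftrightarrow>
     riemannian_metric A g \<and> affine_connection A D \<and> torsion_free A D \<and>
     (\<forall>X\<in>vector_fields A. \<forall>Y\<in>vector_fields A. \<forall>Z\<in>vector_fields A.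
        nabla_metric g D X Y Z = nabla_metric g D Y X Z \<and>
        nabla_metric g D X Y Z = nabla_metric g D X Z Y)"

text \<open>The tensor field \<open>K = D - D\<^sub>0\<close>. A difference of two affine connections is always
  (the operator on vector fields induced by) a unique tensor field, so this predicate only gives
  that tensor field a name.\<close>

definition difference_tensor ::
    "('a, 'e::euclidean_space) chart set \<Rightarrow> 'a connection \<Rightarrow> 'a connection \<Rightarrow>
     ('a \<Rightarrow> 'a tangent \<Rightarrow> 'a tangent \<Rightarrow> 'a tangent) \<Rightarrow> bool" where
  "difference_tensor A D D0 K \<longleftrightarrow> tensor_1_2 A K \<and>
     (\<forall>X\<in>vector_fields A. \<forall>Y\<in>vector_fields A. \<forall>p.
        K p (X p) (Y p) = lincomb 1 (D X Y p) (- 1) (D0 X Y p))"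

section \<open>Almost contact statistical manifolds\<close>

locale almost_contact_metric_manifold = smooth_manifold A
  for A :: "('a::{t2_space, second_countable_topology}, 'e::euclidean_space) chart set" +
  fixes \<phi> :: "'a \<Rightarrow> 'a tangent \<Rightarrow> 'a tangent"
    and \<xi> :: "'a vfield"
    and \<eta> :: "'a \<Rightarrow> 'a tangent \<Rightarrow> real"
    and g :: "'a \<Rightarrow> 'a tangent \<Rightarrow> 'a tangent \<Rightarrow> real"
  assumes odd_dim: "odd DIM('e)"
    and phi_tensor: "tensor_1_1 A \<phi>"
    and xi_vector_field: "\<xi> \<in> vector_fields A"
    and eta_form: "one_form A \<eta>"
    and metric: "riemannian_metric A g"
    and phi_squared: "X \<in> vector_fields A \<Longrightarrow>
      \<phi> p (\<phi> p (X p)) = lincomb (- 1) (X p) (\<eta> p (X p)) (\<xi> p)"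
    and eta_xi: "\<eta> p (\<xi> p) = 1"
    and phi_metric: "X \<in> vector_fields A \<Longrightarrow> Y \<in> vector_fields A \<Longrightarrow>
      g p (\<phi> p (X p)) (\<phi> p (Y p)) = g p (X p) (Y p) - \<eta> p (X p) * \<eta> p (Y p)"

locale almost_contact_statistical_manifold = almost_contact_metric_manifold A \<phi> \<xi> \<eta> g
  for A :: "('a::{t2_space, second_countable_topology}, 'e::euclidean_space) chart set"
    and \<phi> \<xi> \<eta> g +
  fixes D :: "'a connection"
    and D0 :: "'a connection"
    and K :: "'a \<Rightarrow> 'a tangent \<Rightarrow> 'a tangent \<Rightarrow> 'a tangent"
  assumes levi_civita: "levi_civita_connection A g D0"
    and statistical: "statistical_structure A g D"
    and difference: "difference_tensor A D D0 K"
    and K_phi: "X \<in> vector_fields A \<Longrightarrow> Y \<in> vector_fields A \<Longrightarrow>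
      lincomb 1 (K p (X p) (\<phi> p (Y p))) 1 (\<phi> p (K p (X p) (Y p))) = tzero"

definition K_bracket ::
    "('a \<Rightarrow> 'a tangent \<Rightarrow> 'a tangent \<Rightarrow> 'a tangent) \<Rightarrow> 'a \<Rightarrow>
     'a tangent \<Rightarrow> 'a tangent \<Rightarrow> 'a tangent \<Rightarrow> 'a tangent" where
  "K_bracket K p x y z = lincomb 1 (K p x (K p y z)) (- 1) (K p y (K p x z))"

definition phi_sectional_K_curvature ::
    "('a \<Rightarrow> 'a tangent \<Rightarrow> 'a tangent) \<Rightarrow> ('a \<Rightarrow> 'a tangent \<Rightarrow> 'a tangent \<Rightarrow> real) \<Rightarrow>
     ('a \<Rightarrow> 'a tangent \<Rightarrow> 'a tangent \<Rightarrow> 'a tangent) \<Rightarrow> 'a \<Rightarrow> 'a tangent \<Rightarrow> real" where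
  "phi_sectional_K_curvature \<phi> g K p x =
     g p (K_bracket K p x (\<phi> p x) (\<phi> p x)) x
       / (g p x x * g p (\<phi> p x) (\<phi> p x) - (g p x (\<phi> p x))\<^sup>2)"

end

theory Submission
  imports Defs "HOL-Computational_Algebra.Polynomial"
begin

text \<open>Fix \<open>p\<close>, a tangent vector \<open>x\<close> orthogonal to \<open>\<xi>\<close>, and put \<open>w = K(x, x)\<close>. The sign of the
  curvature comes from one identity,
  \<open>g([K, K](x, \<phi>x)\<phi>x, x) = - 2 g(\<phi>w, \<phi>w)\<close> (\<open>g_K_bracket_phi\<close>).
  Indeed each \<open>K\<^sub>u\<close> is self-adjoint for \<open>g\<close> (\<open>g_K_self_adjoint\<close>), so the left-hand side is
  \<open>g(K(\<phi>x, \<phi>x), K(x, x)) - g(K(x, \<phi>x), K(x, \<phi>x))\<close>. The rule \<open>K(u, \<phi>v) = - \<phi>K(u, v)\<close> and the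
  symmetry of \<open>K\<close> give \<open>K(x, \<phi>x) = - \<phi>w\<close> and \<open>K(\<phi>x, \<phi>x) = \<phi>\<phi>w\<close>, and
  \<open>g(\<phi>\<phi>w, w) = - g(\<phi>w, \<phi>w)\<close> because \<open>\<phi>\<close> is skew-adjoint. For the denominator, skew-adjointness also
  gives \<open>g(x, \<phi>x) = 0\<close>, so that \<open>Q(x, \<phi>x) = g(x, x) g(\<phi>x, \<phi>x)\<close> is nonnegative.

  The axioms of the structure speak of global vector fields, while this computation takes place
  in one tangent space. The two are linked by \<open>tangent_vector_extension\<close>: every tangent vector is
  the value of a global smooth vector field, obtained by cutting off a constant vector field of a
  chart with a bump function. The Hausdorff property enters here, since it makes the
  compact support of the cut-off closed in the manifold. The symmetry and self-adjointness of \<open>K\<close>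
  result from comparing \<open>\<nabla>\<close> with the Levi-Civita connection: equal torsion makes \<open>K\<close> symmetric, and
  \<open>\<nabla>g\<close> is determined by \<open>K\<close> because the Levi-Civita connection is metric.\<close>

section \<open>Calculus of maps of class \<open>C\<^sup>k\<close>\<close>

lemma Ck_on_cong:
  assumes "open S" "\<And>x. x \<in> S \<Longrightarrow> f x = g x" "Ck_on k f S"
  shows "Ck_on k g S"
  using assms(2,3)
proof (induction k arbitrary: f g)
  case 0
  then show ?case using continuous_on_cong[of S S f g] by simp
next
  case (Suc k)
  have der: "(g has_derivative frechet_derivative f (at x)) (at x)" if "x \<in> S" for x
  proof (rule has_derivative_transform_within_open[OF _ assms(1) that])
    show "(f has_derivative frechet_derivative f (at x)) (at x)"
      using Suc.prems(2) that by (simp add: frechet_derivative_works)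
  qed (simp add: Suc.prems)
  have "Ck_on k (\<lambda>x. frechet_derivative g (at x) v) S" for v
  proof (rule Suc.IH)
    show "frechet_derivative f (at x) v = frechet_derivative g (at x) v" if "x \<in> S" for x
      using frechet_derivative_at[OF der[OF that]] by simp
    show "Ck_on k (\<lambda>x. frechet_derivative f (at x) v) S" using Suc.prems(2) by simp
  qed
  then show ?case using der by (auto simp: differentiable_def)
qed

text \<open>For computing with a closed form \<open>F\<close> of the derivative in place of the choice operator behind
  \<open>frechet_derivative\<close>.\<close>

lemma Ck_on_SucI:
  assumes "open S" "\<And>x. x \<in> S \<Longrightarrow> (f has_derivative F x) (at x)"
    "\<And>v. Ck_on k (\<lambda>x. F x v) S"
  shows "Ck_on (Suc k) f S"
proof -
  have "Ck_on k (\<lambda>x. frechet_derivative f (at x) v) S" for v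
    using frechet_derivative_at[OF assms(2)] by (intro Ck_on_cong[OF assms(1) _ assms(3)[of v]]) simp
  then show ?thesis using assms(2) by (auto simp: differentiable_def)
qed

lemma Ck_on_Suc_has_derivative:
  "Ck_on (Suc k) f S \<Longrightarrow> x \<in> S \<Longrightarrow> (f has_derivative frechet_derivative f (at x)) (at x)"
  by (simp add: frechet_derivative_works)

lemma Ck_on_SucD: "Ck_on (Suc k) f S \<Longrightarrow> Ck_on k f S"
proof (induction k arbitrary: f)
  case 0
  then show ?case
    by (auto intro!: differentiable_imp_continuous_on simp: differentiable_on_def
        differentiable_at_withinI)
next
  case (Suc k)
  then have "Ck_on k (\<lambda>x. frechet_derivative f (at x) v) S" for v
    by (metis Ck_on.simps(2))
  with Suc.prems show ?case by simp
qed

lemma Ck_on_subset: "Ck_on k f S \<Longrightarrow> T \<subseteq> S \<Longrightarrow> Ck_on k f T"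
  by (induction k arbitrary: f) (auto intro: continuous_on_subset)

lemma Ck_on_local:
  assumes "\<And>x. x \<in> S \<Longrightarrow> \<exists>T. open T \<and> x \<in> T \<and> Ck_on k f T"
  shows "Ck_on k f S"
  using assms
proof (induction k arbitrary: f)
  case 0
  then show ?case
    by (metis Ck_on.simps(1) continuous_at_imp_continuous_on continuous_on_eq_continuous_at)
next
  case (Suc k)
  have "Ck_on k (\<lambda>x. frechet_derivative f (at x) v) S" for v
    by (rule Suc.IH) (use Suc.prems in \<open>fastforce\<close>)
  moreover have "f differentiable (at x)" if "x \<in> S" for x
    using Suc.prems[OF that] by auto
  ultimately show ?case by simp
qed

lemma Ck_on_const: "Ck_on k (\<lambda>x. c) S"
  by (induction k arbitrary: c) (simp_all add: frechet_derivative_const)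

lemma Ck_on_add:
  assumes "open S" "Ck_on k f S" "Ck_on k g S"
  shows "Ck_on k (\<lambda>x. f x + g x) S"
  using assms(2,3)
proof (induction k arbitrary: f g)
  case 0
  then show ?case by (simp add: continuous_on_add)
next
  case (Suc k)
  show ?case
  proof (rule Ck_on_SucI[OF assms(1)])
    show "((\<lambda>x. f x + g x) has_derivative
        (\<lambda>v. frechet_derivative f (at x) v + frechet_derivative g (at x) v)) (at x)"
      if "x \<in> S" for x
      using Suc.prems that by (intro has_derivative_add Ck_on_Suc_has_derivative)
  qed (use Suc in simp)
qed

lemma Ck_on_sum:
  assumes "open S" "finite I" "\<And>i. i \<in> I \<Longrightarrow> Ck_on k (f i) S"
  shows "Ck_on k (\<lambda>x. \<Sum>i\<in>I. f i x) S"
  using assms(2,3)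
  by (induction I rule: finite_induct) (simp_all add: Ck_on_const Ck_on_add[OF assms(1)])

lemma Ck_on_bounded_bilinear:
  assumes "bounded_bilinear B" "open S" "Ck_on k f S" "Ck_on k g S"
  shows "Ck_on k (\<lambda>x. B (f x) (g x)) S"
  using assms(3,4)
proof (induction k arbitrary: f g)
  case 0
  then show ?case by (simp add: bounded_bilinear.continuous_on[OF assms(1)])
next
  case (Suc k)
  show ?case
  proof (rule Ck_on_SucI[OF assms(2)])
    show "((\<lambda>x. B (f x) (g x)) has_derivative
        (\<lambda>v. B (f x) (frechet_derivative g (at x) v) + B (frechet_derivative f (at x) v) (g x)))
        (at x)" if "x \<in> S" for x
      using Suc.prems that
      by (intro bounded_bilinear.FDERIV[OF assms(1)] Ck_on_Suc_has_derivative)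
    show "Ck_on k (\<lambda>x. B (f x) (frechet_derivative g (at x) v)
        + B (frechet_derivative f (at x) v) (g x)) S" for v
      using Suc.prems Ck_on_SucD[OF Suc.prems(1)] Ck_on_SucD[OF Suc.prems(2)]
      by (intro Ck_on_add[OF assms(2)] Suc.IH) simp_all
  qed
qed

lemma Ck_on_bounded_linear:
  assumes "bounded_linear L" "open S"
  shows "Ck_on k L S"
proof (cases k)
  case 0
  then show ?thesis using assms(1) by (simp add: linear_continuous_on)
next
  case (Suc j)
  show ?thesis unfolding Suc
    by (rule Ck_on_SucI[OF assms(2), where F = "\<lambda>x. L"])
      (simp_all add: bounded_linear_imp_has_derivative[OF assms(1)] Ck_on_const)
qed

text \<open>Expanding the inner derivative in a basis turns the chain rule into
  \<open>D(f \<circ> g)(x) v = \<Sum>\<^sub>b \<langle>Dg(x) v, b\<rangle> Df(g x) b\<close>, a sum of products of maps of class \<open>C\<^sup>k\<close> that are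
  either directional derivatives of \<open>g\<close> or compositions with directional derivatives of \<open>f\<close>.\<close>

lemma Ck_on_compose:
  fixes g :: "'e::euclidean_space \<Rightarrow> 'g::euclidean_space" and f :: "'g \<Rightarrow> 'h::real_normed_vector"
  assumes "open S" "g ` S \<subseteq> T" "Ck_on k f T" "Ck_on k g S"
  shows "Ck_on k (\<lambda>x. f (g x)) S"
  using assms(3,4)
proof (induction k arbitrary: f)
  case 0
  then show ?case using assms(2) by (auto intro: continuous_on_compose2)
next
  case (Suc k)
  let ?F = "\<lambda>x v. \<Sum>b\<in>Basis. (frechet_derivative g (at x) v \<bullet> b)
    *\<^sub>R frechet_derivative f (at (g x)) b"
  show ?case
  proof (rule Ck_on_SucI[OF assms(1)])
    fix x assume x: "x \<in> S"
    let ?f' = "frechet_derivative f (at (g x))" and ?g' = "frechet_derivative g (at x)"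
    have f': "(f has_derivative ?f') (at (g x))"
      using x assms(2) by (intro Ck_on_Suc_has_derivative[OF Suc.prems(1)]) auto
    have "?f' w = (\<Sum>b\<in>Basis. (w \<bullet> b) *\<^sub>R ?f' b)" for w
    proof -
      have lin: "linear ?f'" using f' by (rule has_derivative_linear)
      have "?f' w = ?f' (\<Sum>b\<in>Basis. (w \<bullet> b) *\<^sub>R b)" by (simp add: euclidean_representation)
      also have "\<dots> = (\<Sum>b\<in>Basis. (w \<bullet> b) *\<^sub>R ?f' b)"
        by (simp only: linear_sum[OF lin] linear_cmul[OF lin])
      finally show ?thesis .
    qed
    then have "?F x = (\<lambda>v. ?f' (?g' v))" by (intro ext) (rule sym)
    then show "((\<lambda>x. f (g x)) has_derivative ?F x) (at x)"
      using has_derivative_compose[OF Ck_on_Suc_has_derivative[OF Suc.prems(2) x] f'] by simp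
  next
    fix v
    have "Ck_on k (\<lambda>x. frechet_derivative g (at x) v \<bullet> b) S" for b
      using Suc.prems(2)
      by (intro Ck_on_bounded_bilinear[OF bounded_bilinear_inner assms(1)]) (auto simp: Ck_on_const)
    moreover have "Ck_on k (\<lambda>x. frechet_derivative f (at (g x)) b) S" for b
      using Suc.prems(1) by (intro Suc.IH Ck_on_SucD[OF Suc.prems(2)]) simp
    ultimately show "Ck_on k (\<lambda>x. ?F x v) S"
      by (intro Ck_on_sum[OF assms(1)] finite_Basis
          Ck_on_bounded_bilinear[OF bounded_bilinear_scaleR assms(1)])
  qed
qed

lemma smooth_on_has_derivative:
  "smooth_on f S \<Longrightarrow> x \<in> S \<Longrightarrow> (f has_derivative frechet_derivative f (at x)) (at x)"
  unfolding smooth_on_def by (rule Ck_on_Suc_has_derivative) auto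

lemma smooth_on_directional_derivative:
  "smooth_on f S \<Longrightarrow> smooth_on (\<lambda>x. frechet_derivative f (at x) v) S"
  unfolding smooth_on_def by (metis Ck_on.simps(2))

section \<open>Bump functions\<close>

text \<open>The family of all \<open>t \<mapsto> P(1/t) exp(-1/t)\<close>, extended by zero to \<open>t \<le> 0\<close>, is closed under
  differentiation, and so an induction over the order of differentiability works for the whole
  family at once although it would not for \<open>exp(-1/t)\<close> alone.\<close>

definition flat_fun :: "real poly \<Rightarrow> real \<Rightarrow> real" where
  "flat_fun P t = (if t > 0 then poly P (1 / t) * exp (- (1 / t)) else 0)"

lemma poly_times_exp_neg_tendsto_0: "((\<lambda>s::real. poly P s * exp (- s)) \<longlongrightarrow> 0) at_top"
proof -
  have "((\<lambda>s. \<Sum>i\<le>degree P. coeff P i * (s ^ i / exp s)) \<longlongrightarrow> (\<Sum>i\<le>degree P. coeff P i * 0)) at_top"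
    by (intro tendsto_sum tendsto_mult tendsto_const tendsto_power_div_exp_0)
  then show ?thesis
    by (simp add: poly_altdef exp_minus sum_distrib_right divide_inverse mult.assoc)
qed

lemma flat_fun_tendsto_0: "(flat_fun P \<longlongrightarrow> 0) (at 0)"
proof -
  have "eventually (\<lambda>t. flat_fun P t = 0) (at_left 0)"
    by (auto simp: flat_fun_def eventually_at_filter)
  then have left: "(flat_fun P \<longlongrightarrow> 0) (at_left 0)" by (rule tendsto_eventually)
  have "((\<lambda>t. poly P (inverse t) * exp (- inverse t)) \<longlongrightarrow> 0) (at_right 0)"
    by (rule filterlim_compose[OF poly_times_exp_neg_tendsto_0 filterlim_inverse_at_top_right])
  then have "(flat_fun P \<longlongrightarrow> 0) (at_right 0)"
    by (rule Lim_transform_eventually) (auto simp: flat_fun_def eventually_at_filter field_simps)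
  with left show ?thesis by (rule filterlim_split_at)
qed

text \<open>With \<open>s = 1/t\<close>, so that \<open>ds/dt = - s\<^sup>2\<close>, the derivative of \<open>P(s) exp(-s)\<close> is
  \<open>s\<^sup>2 (P(s) - P'(s)) exp(-s)\<close>. At \<open>0\<close> the difference quotient \<open>P(s) exp(-s) / t\<close> belongs again to
  the family, for the polynomial \<open>s P(s)\<close>, and therefore tends to \<open>0\<close>.\<close>

lemma flat_fun_has_real_derivative:
  "(flat_fun P has_real_derivative flat_fun ([:0, 0, 1:] * (P - pderiv P)) t) (at t)"
proof -
  consider "t > 0" | "t < 0" | "t = 0" by linarith
  then show ?thesis
  proof cases
    case 1
    have "((\<lambda>t. poly P (1 / t) * exp (- (1 / t))) has_real_derivative
        flat_fun ([:0, 0, 1:] * (P - pderiv P)) t) (at t)"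
      unfolding flat_fun_def using 1
      by (auto intro!: derivative_eq_intros DERIV_chain2[OF poly_DERIV] simp: field_simps power2_eq_square)
    then show ?thesis
      by (rule has_field_derivative_transform_within_open[OF _ open_greaterThan[of 0]])
        (use 1 in \<open>auto simp: flat_fun_def\<close>)
  next
    case 2
    have "((\<lambda>t. 0) has_real_derivative flat_fun ([:0, 0, 1:] * (P - pderiv P)) t) (at t)"
      using 2 by (simp add: flat_fun_def)
    then show ?thesis
      by (rule has_field_derivative_transform_within_open[OF _ open_lessThan[of 0]])
        (use 2 in \<open>auto simp: flat_fun_def\<close>)
  next
    case 3
    have "(\<lambda>h. (flat_fun P (0 + h) - flat_fun P 0) / h) = flat_fun ([:0, 1:] * P)"
      by (auto simp: flat_fun_def fun_eq_iff field_simps)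
    then show ?thesis
      using flat_fun_tendsto_0[of "[:0, 1:] * P"] by (simp add: 3 DERIV_def flat_fun_def)
  qed
qed

lemma Ck_on_flat_fun: "Ck_on k (flat_fun P) UNIV"
proof (induction k arbitrary: P)
  case 0
  show ?case
    using DERIV_isCont[OF flat_fun_has_real_derivative]
    by (auto intro: continuous_at_imp_continuous_on)
next
  case (Suc k)
  let ?P' = "[:0, 0, 1:] * (P - pderiv P)"
  show ?case
  proof (rule Ck_on_SucI)
    show "(flat_fun P has_derivative (\<lambda>v. flat_fun ?P' t * v)) (at t)" for t
      using flat_fun_has_real_derivative by (rule has_field_derivative_imp_has_derivative)
    have "(\<lambda>t. flat_fun ?P' t * v) = flat_fun (smult v ?P')" for v
      by (auto simp: flat_fun_def fun_eq_iff)
    then show "Ck_on k (\<lambda>t. flat_fun ?P' t * v) UNIV" for v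
      by (simp only: Suc.IH)
  qed simp
qed

text \<open>The bump is \<open>exp(-1/t)\<close> at \<open>t = r\<^sup>2 - |z - z\<^sub>0|\<^sup>2\<close>. Taking the square of the norm keeps the
  argument smooth at \<open>z\<^sub>0\<close>; the factor \<open>exp(1/r\<^sup>2)\<close> normalises the value there.\<close>

lemma bump_function_exists:
  fixes z0 :: "'e::euclidean_space"
  assumes "r > 0"
  shows "\<exists>b::'e \<Rightarrow> real. smooth_on b UNIV \<and> b z0 = 1 \<and> (\<forall>z. z \<notin> cball z0 r \<longrightarrow> b z = 0)"
proof (intro exI conjI allI impI)
  let ?w = "\<lambda>z. r\<^sup>2 - (z - z0) \<bullet> (z - z0)"
  let ?b = "\<lambda>z. exp (1 / r\<^sup>2) *\<^sub>R flat_fun 1 (?w z)"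
  have diff: "Ck_on k (\<lambda>z. z - z0) UNIV" for k
    using Ck_on_add[OF open_UNIV Ck_on_bounded_linear[OF bounded_linear_ident open_UNIV]
        Ck_on_const[of k "- z0"]] by simp
  have "Ck_on k (\<lambda>z. r\<^sup>2 + (-1) *\<^sub>R ((z - z0) \<bullet> (z - z0))) UNIV" for k
    by (intro Ck_on_add Ck_on_const Ck_on_bounded_bilinear[OF bounded_bilinear_scaleR]
        Ck_on_bounded_bilinear[OF bounded_bilinear_inner] diff open_UNIV)
  then have w: "Ck_on k ?w UNIV" for k by simp
  show "smooth_on ?b UNIV"
    unfolding smooth_on_def
    by (intro allI Ck_on_bounded_bilinear[OF bounded_bilinear_scaleR] Ck_on_const open_UNIV
        Ck_on_compose[OF open_UNIV _ Ck_on_flat_fun w]) simp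
  show "?b z0 = 1" using assms by (simp add: flat_fun_def exp_minus)
  show "?b z = 0" if "z \<notin> cball z0 r" for z
  proof -
    have "r < norm (z - z0)" using that by (simp add: dist_norm norm_minus_commute)
    then have "r\<^sup>2 < (norm (z - z0))\<^sup>2" using assms by (simp add: power_strict_mono)
    then show ?thesis by (simp add: flat_fun_def power2_norm_eq_inner)
  qed
qed

section \<open>Tangent vectors and vector fields\<close>

context smooth_manifold
begin

lemma chart_open: "(U, x) \<in> A \<Longrightarrow> open U"
  and chart_homeomorphism: "(U, x) \<in> A \<Longrightarrow> homeomorphism U (x ` U) x (inv_into U x)"
  using charts[of "(U, x)"] by (simp_all add: is_chart_def)

lemma chart_inv: "(U, x) \<in> A \<Longrightarrow> p \<in> U \<Longrightarrow> inv_into U x (x p) = p"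
  using chart_homeomorphism by (auto simp: homeomorphism_def)

lemma open_chart_image:
  assumes "(U, x) \<in> A" "open W" "W \<subseteq> U"
  shows "open (x ` W)"
proof -
  have "openin (top_of_set (x ` U)) (x ` W)"
    using assms by (intro homeomorphism_imp_open_map[OF chart_homeomorphism]) (auto intro: open_subset)
  moreover have "open (x ` U)" using charts[OF assms(1)] by (simp add: is_chart_def)
  ultimately show ?thesis by (simp add: openin_open_eq)
qed

lemma smooth_function_in_chart:
  "f \<in> smooth_functions A \<Longrightarrow> (U, x) \<in> A \<Longrightarrow> smooth_on (f \<circ> inv_into U x) (x ` U)"
  by (auto simp: smooth_functions_def)

lemma coord_vector_lincomb:
  assumes "(U, x) \<in> A" "p \<in> U"
  shows "coord_vector A (U, x) p (a *\<^sub>R v + b *\<^sub>R w)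
    = lincomb a (coord_vector A (U, x) p v) b (coord_vector A (U, x) p w)"
proof
  fix f
  show "coord_vector A (U, x) p (a *\<^sub>R v + b *\<^sub>R w) f
    = lincomb a (coord_vector A (U, x) p v) b (coord_vector A (U, x) p w) f"
  proof (cases "f \<in> smooth_functions A")
    case True
    have "linear (frechet_derivative (f \<circ> inv_into U x) (at (x p)))"
      using smooth_on_has_derivative[OF smooth_function_in_chart[OF True assms(1)]] assms(2)
      by (auto intro: has_derivative_linear)
    with True show ?thesis
      by (simp add: coord_vector_def lincomb_def linear_add linear_cmul)
  qed (simp add: coord_vector_def lincomb_def)
qed

lemma coord_vector_zero:
  assumes "(U, x) \<in> A" "p \<in> U"
  shows "coord_vector A (U, x) p 0 = tzero"
  using coord_vector_lincomb[OF assms, of 0 0 0 0] by (simp add: lincomb_def tzero_def)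

text \<open>The chain rule for \<open>f \<circ> y\<^sup>-\<^sup>1 = (f \<circ> x\<^sup>-\<^sup>1) \<circ> (x \<circ> y\<^sup>-\<^sup>1)\<close>, valid near \<open>y p\<close>. It brings tangent
  vectors that are given in different charts into a common one.\<close>

lemma coord_vector_change_chart:
  assumes U: "(U, x) \<in> A" "p \<in> U" and V: "(V, y) \<in> A" "p \<in> V"
  shows "coord_vector A (V, y) p v
    = coord_vector A (U, x) p (frechet_derivative (x \<circ> inv_into V y) (at (y p)) v)"
proof
  fix f
  show "coord_vector A (V, y) p v f
    = coord_vector A (U, x) p (frechet_derivative (x \<circ> inv_into V y) (at (y p)) v) f"
  proof (cases "f \<in> smooth_functions A")
    case True
    let ?t = "x \<circ> inv_into V y" and ?h = "f \<circ> inv_into U x"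
    have yp: "y p \<in> y ` (V \<inter> U)" using U V by auto
    have t: "(?t has_derivative frechet_derivative ?t (at (y p))) (at (y p))"
      by (rule smooth_on_has_derivative[OF compatible[OF V(1) U(1)] yp])
    have tp: "?t (y p) = x p" using chart_inv[OF V] by simp
    have "(?h has_derivative frechet_derivative ?h (at (x p))) (at (x p))"
      using smooth_on_has_derivative[OF smooth_function_in_chart[OF True U(1)]] U(2) by auto
    then have "(?h has_derivative frechet_derivative ?h (at (x p))) (at (?t (y p)))"
      by (simp only: tp)
    from has_derivative_compose[OF t this]
    have "((f \<circ> inv_into V y) has_derivative
        (\<lambda>v. frechet_derivative ?h (at (x p)) (frechet_derivative ?t (at (y p)) v))) (at (y p))"
    proof (rule has_derivative_transform_within_open)
      show "open (y ` (V \<inter> U))"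
        using V(1) chart_open[OF V(1)] chart_open[OF U(1)] by (intro open_chart_image) auto
      show "y p \<in> y ` (V \<inter> U)" by (rule yp)
      show "?h (?t z) = (f \<circ> inv_into V y) z" if "z \<in> y ` (V \<inter> U)" for z
        using that chart_inv[OF V(1)] chart_inv[OF U(1)] by auto
    qed
    then show ?thesis
      using True by (simp add: coord_vector_def flip: frechet_derivative_at)
  qed (simp add: coord_vector_def)
qed

lemma lincomb_tangent_space:
  assumes "u \<in> tangent_space A p" "w \<in> tangent_space A p"
  shows "lincomb a u b w \<in> tangent_space A p"
proof -
  obtain U x v where U: "u = coord_vector A (U, x) p v" "(U, x) \<in> A" "p \<in> U"
    using assms(1) by (auto simp: tangent_space_def)
  obtain V y v' where V: "w = coord_vector A (V, y) p v'" "(V, y) \<in> A" "p \<in> V"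
    using assms(2) by (auto simp: tangent_space_def)
  have "lincomb a u b w = coord_vector A (U, x) p
      (a *\<^sub>R v + b *\<^sub>R frechet_derivative (x \<circ> inv_into V y) (at (y p)) v')"
    unfolding coord_vector_lincomb[OF U(2,3)] U(1) V(1)
      coord_vector_change_chart[OF U(2,3) V(2,3)] ..
  then show ?thesis using U(2,3) by (auto simp: tangent_space_def)
qed

text \<open>The extension is the coordinate field of the constant \<open>v\<close> in a chart \<open>(U, x)\<close> around \<open>p\<close>, times
  a bump function \<open>b\<close> supported in a closed ball inside \<open>x(U)\<close>. Smoothness is local: points of \<open>U\<close>
  have the neighbourhood \<open>U\<close>, on which the field is smooth in \<open>x\<close>; all other points have as a
  neighbourhood the complement of the compact set \<open>C \<subseteq> U\<close> over the ball, on which the field vanishes.\<close>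

lemma tangent_vector_extension:
  assumes "u \<in> tangent_space A p"
  obtains X where "X \<in> vector_fields A" "X p = u"
proof -
  obtain U x v where u: "u = coord_vector A (U, x) p v" and U: "(U, x) \<in> A" "p \<in> U"
    using assms by (auto simp: tangent_space_def)
  have "open (x ` U)" by (rule open_chart_image[OF U(1) chart_open[OF U(1)] subset_refl])
  then obtain r where r: "r > 0" "cball (x p) r \<subseteq> x ` U"
    using U(2) by (metis imageI open_contains_cball)
  obtain b where b: "smooth_on b UNIV" "b (x p) = (1::real)"
    "\<And>z. z \<notin> cball (x p) r \<Longrightarrow> b z = 0"
    using bump_function_exists[OF r(1), of "x p"] by blast
  define C where "C = inv_into U x ` cball (x p) r"
  have "compact C"
    unfolding C_def using chart_homeomorphism[OF U(1)] r(2)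
    by (intro compact_continuous_image) (auto simp: homeomorphism_def intro: continuous_on_subset)
  \<comment> \<open>This holds since the manifold is Hausdorff.\<close>
  then have "closed C" by (rule compact_imp_closed)
  define X where "X = (\<lambda>q. if q \<in> U then coord_vector A (U, x) q (b (x q) *\<^sub>R v) else tzero)"
  have X_zero: "X q = tzero" if "q \<notin> C" for q
  proof (cases "q \<in> U")
    case True
    have "x q \<notin> cball (x p) r"
      using that chart_inv[OF U(1) True] unfolding C_def by (metis imageI)
    then show ?thesis using True b(3) coord_vector_zero[OF U(1) True] by (simp add: X_def)
  qed (simp add: X_def)
  have tangent: "X q \<in> tangent_space A q" for q
  proof (cases "q \<in> U")
    case True
    then show ?thesis using U(1) by (auto simp: X_def tangent_space_def)
  next
    case False
    have "q \<in> (\<Union>(U, x)\<in>A. U)" by (simp add: cover)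
    then obtain V y where V: "(V, y) \<in> A" "q \<in> V" by auto
    have "X q = coord_vector A (V, y) q 0" using False coord_vector_zero[OF V] by (simp add: X_def)
    then show ?thesis using V unfolding tangent_space_def by blast
  qed
  have smooth: "(\<lambda>q. X q f) \<in> smooth_functions A" if f: "f \<in> smooth_functions A" for f
  proof -
    let ?h = "f \<circ> inv_into U x"
    let ?G = "\<lambda>z. b z *\<^sub>R frechet_derivative ?h (at z) v"
    have h: "smooth_on ?h (x ` U)" by (rule smooth_function_in_chart[OF f U(1)])
    have G: "Ck_on k ?G (x ` U)" for k
      using smooth_on_directional_derivative[OF h] b(1) unfolding smooth_on_def
      by (intro Ck_on_bounded_bilinear[OF bounded_bilinear_scaleR \<open>open (x ` U)\<close>])
        (auto intro: Ck_on_subset)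
    have XG: "X q f = ?G (x q)" if "q \<in> U" for q
    proof -
      have "linear (frechet_derivative ?h (at (x q)))"
        using smooth_on_has_derivative[OF h] that by (auto intro: has_derivative_linear)
      then show ?thesis using that f by (simp add: X_def coord_vector_def linear_cmul)
    qed
    have "Ck_on k ((\<lambda>q. X q f) \<circ> inv_into V y) (y ` V)" if V: "(V, y) \<in> A" for V y k
    proof (rule Ck_on_local)
      fix z assume "z \<in> y ` V"
      then obtain q where q: "z = y q" "q \<in> V" by auto
      show "\<exists>T. open T \<and> z \<in> T \<and> Ck_on k ((\<lambda>q. X q f) \<circ> inv_into V y) T"
      proof (cases "q \<in> U")
        case True
        let ?T = "y ` (V \<inter> U)"
        have op: "open ?T"
          using V chart_open[OF V] chart_open[OF U(1)] by (intro open_chart_image) auto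
        have "Ck_on k (\<lambda>z. ?G ((x \<circ> inv_into V y) z)) ?T"
        proof (rule Ck_on_compose[OF op _ G])
          show "Ck_on k (x \<circ> inv_into V y) ?T"
            using compatible[OF V U(1)] by (simp add: smooth_on_def)
          show "(x \<circ> inv_into V y) ` ?T \<subseteq> x ` U" using chart_inv[OF V] by auto
        qed
        then have "Ck_on k ((\<lambda>q. X q f) \<circ> inv_into V y) ?T"
          by (rule Ck_on_cong[OF op, rotated]) (use chart_inv[OF V] XG in auto)
        then show ?thesis using op q True by blast
      next
        case False
        let ?T = "y ` (V - C)"
        have op: "open ?T"
          using V chart_open[OF V] \<open>closed C\<close> by (intro open_chart_image) auto
        have "C \<subseteq> U" using r(2) chart_inv[OF U(1)] by (force simp: C_def)
        then have "z \<in> ?T" using q False by auto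
        moreover have "Ck_on k ((\<lambda>q. X q f) \<circ> inv_into V y) ?T"
          by (rule Ck_on_cong[OF op _ Ck_on_const[of k 0]])
            (use chart_inv[OF V] X_zero in \<open>auto simp: tzero_def\<close>)
        ultimately show ?thesis using op by blast
      qed
    qed
    then show ?thesis by (auto simp: smooth_functions_def smooth_on_def)
  qed
  show ?thesis
  proof
    show "X \<in> vector_fields A" using tangent smooth by (simp add: vector_fields_def)
    show "X p = u" using U(2) b(2) by (simp add: X_def u)
  qed
qed

end

section \<open>Almost contact metric structures at a point\<close>

context almost_contact_metric_manifold
begin

lemma g_sym: "u \<in> tangent_space A p \<Longrightarrow> v \<in> tangent_space A p \<Longrightarrow> g p u v = g p v u"
  using metric by (simp add: riemannian_metric_def)

lemma g_lincomb_right: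
  "u \<in> tangent_space A p \<Longrightarrow> v \<in> tangent_space A p \<Longrightarrow> w \<in> tangent_space A p \<Longrightarrow>
    g p u (lincomb a v b w) = a * g p u v + b * g p u w"
  using metric by (simp add: riemannian_metric_def linear_form_on_def)

lemma g_lincomb_left:
  "u \<in> tangent_space A p \<Longrightarrow> v \<in> tangent_space A p \<Longrightarrow> w \<in> tangent_space A p \<Longrightarrow>
    g p (lincomb a v b w) u = a * g p v u + b * g p w u"
  using g_lincomb_right[of u p v w a b] by (simp add: g_sym lincomb_tangent_space)

lemma g_tzero_right: "u \<in> tangent_space A p \<Longrightarrow> g p u tzero = 0"
  using g_lincomb_right[of u p u u 0 0] by (simp add: lincomb_def tzero_def)

lemma g_nonneg: "u \<in> tangent_space A p \<Longrightarrow> 0 \<le> g p u u"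
  using metric g_tzero_right[of u p]
  by (cases "u = tzero") (simp_all add: riemannian_metric_def less_imp_le)

lemma phi_tangent: "u \<in> tangent_space A p \<Longrightarrow> \<phi> p u \<in> tangent_space A p"
  using phi_tensor by (simp add: tensor_1_1_def linear_map_on_def)

lemma phi_lincomb:
  "u \<in> tangent_space A p \<Longrightarrow> v \<in> tangent_space A p \<Longrightarrow>
    \<phi> p (lincomb a u b v) = lincomb a (\<phi> p u) b (\<phi> p v)"
  using phi_tensor by (simp add: tensor_1_1_def linear_map_on_def)

lemma xi_tangent: "\<xi> p \<in> tangent_space A p"
  using xi_vector_field by (simp add: vector_fields_def)

lemma phi_phi:
  assumes "u \<in> tangent_space A p"
  shows "\<phi> p (\<phi> p u) = lincomb (- 1) u (\<eta> p u) (\<xi> p)"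
proof -
  obtain X where "X \<in> vector_fields A" "X p = u" using tangent_vector_extension[OF assms] by blast
  then show ?thesis using phi_squared[of X p] by simp
qed

lemma g_phi_phi:
  assumes "u \<in> tangent_space A p" "v \<in> tangent_space A p"
  shows "g p (\<phi> p u) (\<phi> p v) = g p u v - \<eta> p u * \<eta> p v"
proof -
  obtain X Y where "X \<in> vector_fields A" "X p = u" "Y \<in> vector_fields A" "Y p = v"
    using tangent_vector_extension assms by metis
  then show ?thesis using phi_metric by blast
qed

text \<open>From \<open>\<phi>\<^sup>2\<xi> = - \<xi> + \<eta>(\<xi>)\<xi> = 0\<close> it follows that \<open>0 = \<phi>\<^sup>2(\<phi>\<xi>) = - \<phi>\<xi> + c\<xi>\<close> with \<open>c = \<eta>(\<phi>\<xi>)\<close>, hence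
  \<open>\<phi>\<xi> = c\<xi>\<close>. Applying \<open>\<phi>\<close> again gives \<open>0 = c \<phi>\<xi>\<close>, and either factor being zero yields the claim.\<close>

lemma phi_xi: "\<phi> p (\<xi> p) = tzero"
proof -
  let ?c = "\<eta> p (\<phi> p (\<xi> p))"
  have phi_phi_xi: "\<phi> p (\<phi> p (\<xi> p)) = tzero"
    using phi_phi[OF xi_tangent] by (simp add: eta_xi lincomb_def tzero_def)
  have "\<phi> p (lincomb 0 (\<xi> p) 0 (\<xi> p)) = lincomb 0 (\<phi> p (\<xi> p)) 0 (\<phi> p (\<xi> p))"
    by (rule phi_lincomb[OF xi_tangent xi_tangent])
  then have phi_tzero: "\<phi> p tzero = tzero" by (simp add: lincomb_def tzero_def)
  have "lincomb (- 1) (\<phi> p (\<xi> p)) ?c (\<xi> p) = tzero"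
    using phi_phi[OF phi_tangent[OF xi_tangent], of p] phi_phi_xi phi_tzero by simp
  \<comment> \<open>A scalar multiple \<open>c u\<close> is written as \<open>lincomb c u 0 u\<close> so that linearity applies to it.\<close>
  then have multiple: "\<phi> p (\<xi> p) = lincomb ?c (\<xi> p) 0 (\<xi> p)"
    by (simp add: lincomb_def tzero_def fun_eq_iff)
  then have "\<phi> p (\<phi> p (\<xi> p)) = lincomb ?c (\<phi> p (\<xi> p)) 0 (\<phi> p (\<xi> p))"
    using phi_lincomb[OF xi_tangent xi_tangent] by metis
  then have "?c = 0 \<or> \<phi> p (\<xi> p) = tzero"
    using phi_phi_xi by (auto simp: lincomb_def tzero_def fun_eq_iff)
  then show ?thesis
  proof
    assume "?c = 0"
    then show ?thesis using multiple by (simp add: lincomb_def tzero_def)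
  qed
qed

text \<open>The compatibility of \<open>g\<close> with \<open>\<phi>\<close> for the pair \<open>u, \<xi>\<close> reads \<open>0 = g(u, \<xi>) - \<eta>(u)\<close>.\<close>

lemma eta_eq_g_xi:
  assumes "u \<in> tangent_space A p"
  shows "\<eta> p u = g p u (\<xi> p)"
  using g_phi_phi[OF assms xi_tangent] phi_xi eta_xi g_tzero_right[OF phi_tangent[OF assms]]
  by simp

lemma g_phi_phi_self:
  assumes "w \<in> tangent_space A p"
  shows "g p (\<phi> p (\<phi> p w)) w = - g p (\<phi> p w) (\<phi> p w)"
  using assms by (simp add: phi_phi g_phi_phi g_lincomb_left xi_tangent eta_eq_g_xi g_sym[OF xi_tangent])

text \<open>Compatibility gives \<open>g(\<phi>u, \<phi>\<phi>u) = g(u, \<phi>u)\<close>, as \<open>\<eta>(u) = 0\<close>; but \<open>\<phi>\<phi>u = - u\<close>, so the same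
  number is \<open>- g(\<phi>u, u)\<close>.\<close>

lemma g_phi_self_zero:
  assumes "u \<in> tangent_space A p" "g p u (\<xi> p) = 0"
  shows "g p u (\<phi> p u) = 0"
proof -
  have "g p (\<phi> p u) (\<phi> p (\<phi> p u)) = g p u (\<phi> p u)"
    using assms by (simp add: g_phi_phi phi_tangent eta_eq_g_xi)
  moreover have "g p (\<phi> p u) (\<phi> p (\<phi> p u)) = - g p (\<phi> p u) u"
    using assms
    by (simp add: phi_phi[OF assms(1)] g_lincomb_right phi_tangent xi_tangent eta_eq_g_xi)
  ultimately show ?thesis using g_sym[OF assms(1) phi_tangent[OF assms(1)]] by simp
qed

end

section \<open>The difference tensor\<close>

context almost_contact_statistical_manifold
begin

lemma K_tangent:
  "u \<in> tangent_space A p \<Longrightarrow> v \<in> tangent_space A p \<Longrightarrow> K p u v \<in> tangent_space A p"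
  using difference by (simp add: difference_tensor_def tensor_1_2_def linear_map_on_def)

lemma D_eq_D0_plus_K:
  "X \<in> vector_fields A \<Longrightarrow> Y \<in> vector_fields A \<Longrightarrow>
    D X Y p = lincomb 1 (D0 X Y p) 1 (K p (X p) (Y p))"
  using difference by (simp add: difference_tensor_def lincomb_def fun_eq_iff)

text \<open>Both connections are torsion-free, so the antisymmetric part of their difference vanishes.\<close>

lemma K_sym:
  assumes "u \<in> tangent_space A p" "v \<in> tangent_space A p"
  shows "K p u v = K p v u"
proof -
  obtain X Y where X: "X \<in> vector_fields A" "X p = u" and Y: "Y \<in> vector_fields A" "Y p = v"
    using tangent_vector_extension assms by metis
  have "torsion_free A D" "torsion_free A D0"
    using statistical levi_civita by (simp_all add: statistical_structure_def levi_civita_connection_def)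
  then have "(\<lambda>p. lincomb 1 (D X Y p) (- 1) (D Y X p)) = (\<lambda>p. lincomb 1 (D0 X Y p) (- 1) (D0 Y X p))"
    using X(1) Y(1) by (simp add: torsion_free_def)
  then have "lincomb 1 (D X Y p) (- 1) (D Y X p) = lincomb 1 (D0 X Y p) (- 1) (D0 Y X p)"
    by (rule fun_cong)
  then show ?thesis
    using X(2) Y(2) by (simp add: D_eq_D0_plus_K[OF X(1) Y(1)] D_eq_D0_plus_K[OF Y(1) X(1)]
        lincomb_def fun_eq_iff)
qed

text \<open>Subtracting the covariant derivative of \<open>g\<close> for the Levi-Civita connection, which is zero,
  from \<open>\<nabla>g\<close> cancels the derivative of \<open>g(Y, Z)\<close> and leaves a pointwise expression in \<open>K\<close>.\<close>

lemma nabla_metric_eq_K: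
  assumes X: "X \<in> vector_fields A" and Y: "Y \<in> vector_fields A" and Z: "Z \<in> vector_fields A"
  shows "nabla_metric g D X Y Z p = - g p (K p (X p) (Y p)) (Z p) - g p (Y p) (K p (X p) (Z p))"
proof -
  have T: "W p \<in> tangent_space A p" if "W \<in> vector_fields A" for W
    using that by (simp add: vector_fields_def)
  have D0: "D0 X W p \<in> tangent_space A p" if "W \<in> vector_fields A" for W
    using levi_civita X that
    by (intro T) (simp add: levi_civita_connection_def affine_connection_def)
  have "nabla_metric g D0 X Y Z p = 0"
    using levi_civita assms by (simp add: levi_civita_connection_def)
  then show ?thesis
    by (simp add: nabla_metric_def D_eq_D0_plus_K assms g_lincomb_left g_lincomb_right T D0 K_tangent)
qed

text \<open>Exchanging the first two arguments of \<open>\<nabla>g\<close> leaves the term \<open>g(K(X, Y), Z)\<close> unchanged, because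
  \<open>K\<close> is symmetric; so the other term must be invariant as well.\<close>

lemma g_K_swap:
  assumes "u \<in> tangent_space A p" "v \<in> tangent_space A p" "w \<in> tangent_space A p"
  shows "g p u (K p v w) = g p v (K p u w)"
proof -
  obtain X Y Z where X: "X \<in> vector_fields A" "X p = u" and Y: "Y \<in> vector_fields A" "Y p = v"
    and Z: "Z \<in> vector_fields A" "Z p = w"
    using tangent_vector_extension assms by metis
  have "nabla_metric g D Y X Z p = nabla_metric g D X Y Z p"
    using statistical X(1) Y(1) Z(1) unfolding statistical_structure_def by metis
  then show ?thesis
    using X(2) Y(2) Z(2) assms
    by (simp add: nabla_metric_eq_K X(1) Y(1) Z(1) K_sym[of v p u])
qed

text \<open>The trilinear form \<open>g(u, K(v, w))\<close> is invariant under exchanging \<open>u, v\<close> and under exchanging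
  \<open>v, w\<close>, hence under all permutations.\<close>

lemma g_K_self_adjoint:
  assumes "u \<in> tangent_space A p" "v \<in> tangent_space A p" "w \<in> tangent_space A p"
  shows "g p (K p u v) w = g p v (K p u w)"
proof -
  have "g p (K p u v) w = g p w (K p u v)" using assms by (simp add: g_sym K_tangent)
  also have "\<dots> = g p u (K p v w)" using assms by (simp add: g_K_swap[of w p u] K_sym[of w p v])
  also have "\<dots> = g p v (K p u w)" using assms by (rule g_K_swap)
  finally show ?thesis .
qed

lemma K_phi_right:
  assumes "u \<in> tangent_space A p" "v \<in> tangent_space A p"
  shows "K p u (\<phi> p v) = lincomb (- 1) (\<phi> p (K p u v)) 0 (\<phi> p (K p u v))"
proof -
  obtain X Y where "X \<in> vector_fields A" "X p = u" "Y \<in> vector_fields A" "Y p = v"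
    using tangent_vector_extension assms by metis
  then have "lincomb 1 (K p u (\<phi> p v)) 1 (\<phi> p (K p u v)) = tzero" using K_phi by blast
  then show ?thesis by (simp add: lincomb_def tzero_def fun_eq_iff eq_neg_iff_add_eq_0)
qed

text \<open>By symmetry of \<open>K\<close>, \<open>\<phi>\<close> can be moved out of either argument; the two signs cancel.\<close>

lemma K_phi_phi:
  assumes "u \<in> tangent_space A p"
  shows "K p (\<phi> p u) (\<phi> p u) = \<phi> p (\<phi> p (K p u u))"
proof -
  let ?w = "K p u u"
  have T: "\<phi> p u \<in> tangent_space A p" "\<phi> p ?w \<in> tangent_space A p"
    using assms by (simp_all add: phi_tangent K_tangent)
  have "K p (\<phi> p u) u = lincomb (- 1) (\<phi> p ?w) 0 (\<phi> p ?w)"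
    using assms T by (simp add: K_sym[of "\<phi> p u" p u] K_phi_right)
  then have "\<phi> p (K p (\<phi> p u) u) = lincomb (- 1) (\<phi> p (\<phi> p ?w)) 0 (\<phi> p (\<phi> p ?w))"
    using T by (simp add: phi_lincomb)
  then show ?thesis
    using assms T by (simp add: K_phi_right lincomb_def fun_eq_iff)
qed

text \<open>Self-adjointness moves the outer \<open>K\<^sub>u\<close> and \<open>K\<^bsub>\<phi>u\<^esub>\<close> of the bracket to the last argument \<open>u\<close>. With
  \<open>w = K(u, u)\<close>, the first term becomes \<open>g(\<phi>\<phi>w, w) = - g(\<phi>w, \<phi>w)\<close> and the subtracted one
  \<open>g(- \<phi>w, - \<phi>w)\<close>: both contribute with the same sign.\<close>

lemma g_K_bracket_phi:
  assumes u: "u \<in> tangent_space A p"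
  shows "g p (K_bracket K p u (\<phi> p u) (\<phi> p u)) u
    = - 2 * g p (\<phi> p (K p u u)) (\<phi> p (K p u u))"
proof -
  let ?y = "\<phi> p u" and ?w = "K p u u"
  have T: "?y \<in> tangent_space A p" "?w \<in> tangent_space A p" "\<phi> p ?w \<in> tangent_space A p"
    using u by (simp_all add: phi_tangent K_tangent)
  have "g p (K p u (K p ?y ?y)) u = g p (\<phi> p (\<phi> p ?w)) ?w"
    using u T by (simp add: g_K_self_adjoint K_tangent K_phi_phi phi_tangent)
  then have 1: "g p (K p u (K p ?y ?y)) u = - g p (\<phi> p ?w) (\<phi> p ?w)"
    using T by (simp add: g_phi_phi_self)
  have "g p (K p ?y (K p u ?y)) u = g p (K p u ?y) (K p u ?y)"
    using u T by (simp add: g_K_self_adjoint[of ?y] K_tangent K_sym[of ?y p u])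
  also have "\<dots> = g p (\<phi> p ?w) (\<phi> p ?w)"
    using u T by (simp add: K_phi_right g_lincomb_left g_lincomb_right lincomb_tangent_space)
  finally have 2: "g p (K p ?y (K p u ?y)) u = g p (\<phi> p ?w) (\<phi> p ?w)" .
  show ?thesis
    unfolding K_bracket_def using u T 1 2 by (simp add: g_lincomb_left K_tangent)
qed

end

theorem theorem5p3:
  fixes A :: "('a::{t2_space, second_countable_topology}, 'e::euclidean_space) chart set"
    and \<phi> :: "'a \<Rightarrow> 'a tangent \<Rightarrow> 'a tangent"
    and \<xi> :: "'a vfield"
    and \<eta> :: "'a \<Rightarrow> 'a tangent \<Rightarrow> real"
    and g :: "'a \<Rightarrow> 'a tangent \<Rightarrow> 'a tangent \<Rightarrow> real"
    and D D0 :: "'a connection"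
    and K :: "'a \<Rightarrow> 'a tangent \<Rightarrow> 'a tangent \<Rightarrow> 'a tangent"
  assumes "almost_contact_statistical_manifold A \<phi> \<xi> \<eta> g D D0 K"
  shows "\<forall>p. \<forall>x\<in>tangent_space A p. x \<noteq> tzero \<longrightarrow> g p x (\<xi> p) = 0 \<longrightarrow>
    phi_sectional_K_curvature \<phi> g K p x \<le> 0"
proof (intro allI ballI impI)
  interpret almost_contact_statistical_manifold A \<phi> \<xi> \<eta> g D D0 K by fact
  fix p x assume x: "x \<in> tangent_space A p" and orth: "g p x (\<xi> p) = 0"
  let ?w = "K p x x"
  have "0 \<le> g p (\<phi> p ?w) (\<phi> p ?w)" "0 \<le> g p x x" "0 \<le> g p (\<phi> p x) (\<phi> p x)"
    using x by (simp_all add: g_nonneg phi_tangent K_tangent)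
  moreover have "phi_sectional_K_curvature \<phi> g K p x
      = - 2 * g p (\<phi> p ?w) (\<phi> p ?w) / (g p x x * g p (\<phi> p x) (\<phi> p x))"
    using x orth by (simp add: phi_sectional_K_curvature_def g_K_bracket_phi g_phi_self_zero)
  ultimately show "phi_sectional_K_curvature \<phi> g K p x \<le> 0"
    by (simp add: divide_nonneg_nonneg)
qed

end
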